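(* For all nonnegative rationals $\varepsilon,\varepsilon'$, every CMK $(M,\Sigma,\theta)$, every $m\in M$ and every $\phi\in\mathcal L$: 1. $m\models_{\varepsilon+\varepsilon'}\phi$ iff $m\models_\varepsilon\langle\phi\rangle_{\varepsilon'}$; 2. $m\models_\varepsilon\phi$ iff $m\models_{\varepsilon+\varepsilon'}\langle\phi\rangle^{\varepsilon'}$.
   Context: A continuous Markov kernel (CMK) is $(M,\Sigma,\theta)$ where $(M,\Sigma)$ is an analytic space with Borel $\sigma$-algebra $\Sigma$ and $\theta$ is a measurable map from $M$ to the space of (finite, nonnegative) measures on $(M,\Sigma)$ (the latter with the $\sigma$-algebra generated by the sets $\{\mu:\mu(S)\geq r\}$, $S\in\Sigma$, $r>0$). Formulae $\mathcal L$: $\phi::=\top\mid\neg\phi\mid\phi\land\phi\mid L_r\phi$, $r$ a nonnegative rational. $\varepsilon$-satisfaction (rational $\varepsilon\ge0$): $m\models_\varepsilon\top$; $m\models_\varepsilon\neg\phi$ iff not $m\models_\varepsilon\phi$; $m\models_\varepsilon\phi\land\psi$ iff both; $m\models_\varepsilon L_r\phi$ iff $\theta(m)(\llbracket\phi\rrbracket_\varepsilon)+\varepsilon\geq r$, with $\llbracket\phi\rrbracket_\varepsilon=\{m'\in M:m'\models_\varepsilon\phi\}$. Encodings: $\langle\cdot\rangle_\varepsilon,\langle\cdot\rangle^\varepsilon:\mathcal L\to\mathcal L$ commute with $\top$, $\neg$, $\land$, and $\langle L_r\phi\rangle_\varepsilon=L_{r\dot-\varepsilon}\langle\phi\rangle_\varepsilon$,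 $\langle L_r\phi\rangle^\varepsilon=L_{r+\varepsilon}\langle\phi\rangle^\varepsilon$, where $r\dot-\varepsilon=\max\{0,r-\varepsilon\}$. *)

theory Defs
  imports "HOL-Analysis.Analysis"
begin

section \<open>Analytic spaces\<close>

definition polish_topology :: "'a topology \<Rightarrow> bool" where
  "polish_topology X \<longleftrightarrow> completely_metrizable_space X \<and> separable_space X"

text \<open>A topological space is analytic if it is the image of a Polish space under a continuous map
  into a Polish space, with the subspace topology. As one cannot quantify existentially over types,
  the two Polish spaces are taken with points in \<^typ>\<open>real\<close>. Up to homeomorphism this is no
  restriction, because a Polish space has at most continuum many points.\<close>

definition analytic_topology :: "'a topology \<Rightarrow> bool" where
  "analytic_topology X \<longleftrightarrow>
     (\<exists>(Y :: real topology) (Z :: real topology) f.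
        polish_topology Y \<and> polish_topology Z \<and> continuous_map Y Z f \<and>
        X homeomorphic_space subtopology Z (f ` topspace Y))"

definition borel_of :: "'a topology \<Rightarrow> 'a measure" where
  "borel_of X = sigma (topspace X) {U. openin X U}"


section \<open>Continuous Markov kernels\<close>

definition finite_measures :: "'a measure \<Rightarrow> 'a measure set" where
  "finite_measures M = {\<mu>. sets \<mu> = sets M \<and> finite_measure \<mu>}"

definition finite_measure_algebra :: "'a measure \<Rightarrow> 'a measure measure" where
  "finite_measure_algebra M =
     sigma (finite_measures M)
       {{\<mu> \<in> finite_measures M. r \<le> measure \<mu> S} | S (r :: real). S \<in> sets M \<and> 0 < r}"

text \<open>\<open>M\<close> only serves as a measurable space, through \<^term>\<open>space M\<close> and
  \<^term>\<open>sets M\<close>; the measure it carries is irrelevant.\<close>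

definition cmk :: "'a measure \<Rightarrow> ('a \<Rightarrow> 'a measure) \<Rightarrow> bool" where
  "cmk M \<theta> \<longleftrightarrow>
     (\<exists>X. analytic_topology X \<and> space M = topspace X \<and> sets M = sets (borel_of X)) \<and>
     \<theta> \<in> M \<rightarrow>\<^sub>M finite_measure_algebra M"


section \<open>Nonnegative rationals\<close>

typedef nnrat = "{q :: rat. 0 \<le> q}"
  morphisms rat_of_nnrat Abs_nnrat
  by (rule exI[of _ 0]) simp

setup_lifting type_definition_nnrat

instantiation nnrat :: plus
begin

lift_definition plus_nnrat :: "nnrat \<Rightarrow> nnrat \<Rightarrow> nnrat" is "(+)"
  by simp

instance ..

end

lift_definition monus :: "nnrat \<Rightarrow> nnrat \<Rightarrow> nnrat" (infixl "\<ominus>" 65) is "\<lambda>r e. max 0 (r - e)"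
  by simp

definition real_of_nnrat :: "nnrat \<Rightarrow> real" where
  "real_of_nnrat q = of_rat (rat_of_nnrat q)"


section \<open>Formulae, satisfaction and encodings\<close>

datatype formula = Top | Neg formula | Conj formula formula | L nnrat formula

primrec sat :: "'a measure \<Rightarrow> ('a \<Rightarrow> 'a measure) \<Rightarrow> nnrat \<Rightarrow> 'a \<Rightarrow> formula \<Rightarrow> bool" where
  "sat M \<theta> \<epsilon> m Top \<longleftrightarrow> True"
| "sat M \<theta> \<epsilon> m (Neg \<phi>) \<longleftrightarrow> \<not> sat M \<theta> \<epsilon> m \<phi>"
| "sat M \<theta> \<epsilon> m (Conj \<phi> \<psi>) \<longleftrightarrow> sat M \<theta> \<epsilon> m \<phi> \<and> sat M \<theta> \<epsilon> m \<psi>"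
| "sat M \<theta> \<epsilon> m (L r \<phi>) \<longleftrightarrow>
     measure (\<theta> m) {m' \<in> space M. sat M \<theta> \<epsilon> m' \<phi>} + real_of_nnrat \<epsilon> \<ge> real_of_nnrat r"

primrec enc_lower :: "nnrat \<Rightarrow> formula \<Rightarrow> formula" where
  "enc_lower \<epsilon> Top = Top"
| "enc_lower \<epsilon> (Neg \<phi>) = Neg (enc_lower \<epsilon> \<phi>)"
| "enc_lower \<epsilon> (Conj \<phi> \<psi>) = Conj (enc_lower \<epsilon> \<phi>) (enc_lower \<epsilon> \<psi>)"
| "enc_lower \<epsilon> (L r \<phi>) = L (r \<ominus> \<epsilon>) (enc_lower \<epsilon> \<phi>)"

primrec enc_upper :: "nnrat \<Rightarrow> formula \<Rightarrow> formula" where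
  "enc_upper \<epsilon> Top = Top"
| "enc_upper \<epsilon> (Neg \<phi>) = Neg (enc_upper \<epsilon> \<phi>)"
| "enc_upper \<epsilon> (Conj \<phi> \<psi>) = Conj (enc_upper \<epsilon> \<phi>) (enc_upper \<epsilon> \<psi>)"
| "enc_upper \<epsilon> (L r \<phi>) = L (r + \<epsilon>) (enc_upper \<epsilon> \<phi>)"

text \<open>In a continuous Markov kernel the set measured in the clause for \<^const>\<open>L\<close> is always
  measurable, so the default value of \<^const>\<open>measure\<close> on non-measurable sets plays no role.\<close>

lemma sat_measurable:
  assumes "cmk M \<theta>"
  shows "{m \<in> space M. sat M \<theta> \<epsilon> m \<phi>} \<in> sets M"
proof (induction \<phi>)
  case (L r \<phi>)
  let ?S = "{m \<in> space M. sat M \<theta> \<epsilon> m \<phi>}"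
  let ?c = "real_of_nnrat r - real_of_nnrat \<epsilon>"
  let ?G = "{{\<mu> \<in> finite_measures M. r \<le> measure \<mu> S} | S (r :: real). S \<in> sets M \<and> 0 < r}"
  have \<theta>: "\<theta> \<in> M \<rightarrow>\<^sub>M finite_measure_algebra M"
    using assms by (simp add: cmk_def)
  have G: "?G \<subseteq> Pow (finite_measures M)"
    by auto
  have sp: "\<theta> m \<in> finite_measures M" if "m \<in> space M" for m
    using measurable_space[OF \<theta> that] G
    by (simp add: finite_measure_algebra_def space_measure_of)
  have "{m \<in> space M. ?c \<le> measure (\<theta> m) ?S} \<in> sets M"
  proof (cases "0 < ?c")
    case True
    let ?A = "{\<mu> \<in> finite_measures M. ?c \<le> measure \<mu> ?S}"
    have "?A \<in> ?G"
      using L True by blast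
    then have "?A \<in> sets (finite_measure_algebra M)"
      using G by (simp add: finite_measure_algebra_def sigma_sets.Basic)
    then have "\<theta> -` ?A \<inter> space M \<in> sets M"
      by (rule measurable_sets[OF \<theta>])
    also have "\<theta> -` ?A \<inter> space M = {m \<in> space M. ?c \<le> measure (\<theta> m) ?S}"
      using sp by auto
    finally show ?thesis .
  next
    case False
    then have "{m \<in> space M. ?c \<le> measure (\<theta> m) ?S} = space M"
      by (auto simp: not_less intro: order_trans[OF _ measure_nonneg])
    then show ?thesis
      by simp
  qed
  then show ?case
    by (simp add: diff_le_eq)
qed (auto intro: sets.sets_Collect)

end

theory Submission
  imports Defs
begin

text \<open>Induction on \<phi>. Only \<open>L r\<close> matters: by induction both sides measure
  the same set, of mass x say, and it remains to shift \<epsilon>' across an inequality. x +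
  \<epsilon> + \<epsilon>' \<ge> r iff x + \<epsilon> \<ge> r - \<epsilon>' gives
  \<open>sat_enc_lower\<close>; adding \<epsilon>' to both sides gives
  \<open>sat_enc_upper\<close>.\<close>

lemma real_of_nnrat_nonneg: "0 \<le> real_of_nnrat q"
  using rat_of_nnrat[of q] by (simp add: real_of_nnrat_def)

lemma real_of_nnrat_plus: "real_of_nnrat (p + q) = real_of_nnrat p + real_of_nnrat q"
  by (simp add: real_of_nnrat_def plus_nnrat.rep_eq of_rat_add)

lemma real_of_nnrat_monus: "real_of_nnrat (p \<ominus> q) = max 0 (real_of_nnrat p - real_of_nnrat q)"
  by (simp add: real_of_nnrat_def monus.rep_eq max_def of_rat_diff of_rat_less_eq)

text \<open>Truncating the threshold at 0 is harmless, since the left-hand side of the clause for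
  \<^const>\<open>L\<close> is never negative.\<close>

lemma sat_enc_lower: "sat M \<theta> \<epsilon> m (enc_lower \<epsilon>' \<phi>) \<longleftrightarrow> sat M \<theta> (\<epsilon> + \<epsilon>') m \<phi>"
\<comment> \<open>The point varies because \<open>L\<close> evaluates its subformula on all of
  \<open>space M\<close>.\<close>
proof (induction \<phi> arbitrary: m)
  case (L r \<phi>)
  have "0 \<le> measure (\<theta> m) {m' \<in> space M. sat M \<theta> (\<epsilon> + \<epsilon>') m' \<phi>} + real_of_nnrat \<epsilon>"
    by (simp add: real_of_nnrat_nonneg)
  then show ?case
    by (auto simp: L real_of_nnrat_plus real_of_nnrat_monus)
qed simp_all

text \<open>Here \<epsilon>' cancels exactly: raising a threshold involves no truncation, hence no
  sign argument.\<close>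

lemma sat_enc_upper: "sat M \<theta> (\<epsilon> + \<epsilon>') m (enc_upper \<epsilon>' \<phi>) \<longleftrightarrow> sat M \<theta> \<epsilon> m \<phi>"
  by (induction \<phi> arbitrary: m) (simp_all add: real_of_nnrat_plus)

theorem theorem2:
  fixes \<epsilon> \<epsilon>' :: nnrat
    and M :: "'a measure" and \<theta> :: "'a \<Rightarrow> 'a measure"
    and m :: 'a and \<phi> :: formula
  assumes "cmk M \<theta>" and "m \<in> space M"
  shows "(sat M \<theta> (\<epsilon> + \<epsilon>') m \<phi> \<longleftrightarrow> sat M \<theta> \<epsilon> m (enc_lower \<epsilon>' \<phi>)) \<and>
         (sat M \<theta> \<epsilon> m \<phi> \<longleftrightarrow> sat M \<theta> (\<epsilon> + \<epsilon>') m (enc_upper \<epsilon>' \<phi>))"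
  by (simp add: sat_enc_lower sat_enc_upper)

end
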